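(* Let $M=(E,\mathcal{I})$ be a gammoid, and let $B\subseteq E$ be a base of $M$. Then there is a digraph $D=(V,A)$ such that $(D,B,E)$ is a standard representation of $M$.
   Context: Matroids are pairs $M=(E,\mathcal{I})$ with $E$ a finite set and $\mathcal{I}$ the family of independent subsets of $E$. A digraph is a pair $D=(V,A)$ with $V$ a finite set and $A\subseteq V\times V$ (loops allowed, no parallel arcs). A vertex is a source if no arc enters it, and a sink if no arc leaves it. A path in $D$ is a non-empty, non-repeating sequence $p=(p_1p_2\ldots p_n)$ of vertices with $(p_i,p_{i+1})\in A$ for $1\le i<n$ (single-vertex paths are allowed); $p_{-1}$ denotes its last vertex $p_n$, and $|p|=\{p_1,\ldots,p_n\}$. For $X,Y\subseteq V$, a routing from $X$ to $Y$ in $D$ is a set $R$ of paths in $D$ such that (i) for each $x\in X$ there is $p\in R$ with $p_1=x$; (ii) $p_{-1}\in Y$ for all $p\in R$; (iii) for all $p,q\in R$, either $p=q$ or $|p|\cap|q|=\emptyset$. For a digraph $D=(V,A)$ and $E,T\subseteq V$, the gammoid represented by $(D,T,E)$ is the matroid $\Gamma(D,T,E)=(E,\mathcal{I})$, where $\mathcal{I}$ consists of all $X\subseteq E$ for which there is a routing from $X$ to $T$ in $D$. A matroid $M=(E,\mathcal{I})$ is a gammoid if $M=\Gamma(D,T,E)$ for some digraph $D=(V,A)$ with $E\subseteq V$ and some $T\subseteq V$; then $(D,T,E)$ is called a representation of $M$. A representation $(D,T,E)$ of $M$ is a standard representation of $M$ if (i) $T\subseteq E$, (ii) every $t\in T$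 is a sink in $D$, and (iii) every $e\in E\setminus T$ is a source in $D$. *)

theory Defs
  imports
    "HOL-Library.Infinite_Typeclass"
    "Graph_Theory.Pair_Digraph"
    "Graph_Theory.Vertex_Walk"
begin

text \<open>
  Digraphs are finite well-formed \<^typ>\<open>'a pair_pre_digraph\<close>s: arcs are pairs of vertices,
  loops are allowed, parallel arcs are not. Paths are the library's \<^const>\<open>vpath\<close>s:
  non-empty lists of pairwise distinct vertices, consecutive ones joined by an arc.
\<close>

locale matroid =
  fixes E :: "'a set" and I :: "'a set set"
  assumes finite_ground: "finite E"
    and indep_subset_ground: "X \<in> I \<Longrightarrow> X \<subseteq> E"
    and empty_indep: "{} \<in> I"
    and indep_subset: "\<lbrakk>X \<in> I; Y \<subseteq> X\<rbrakk> \<Longrightarrow> Y \<in> I"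
    and indep_augment: "\<lbrakk>X \<in> I; Y \<in> I; card X < card Y\<rbrakk> \<Longrightarrow> \<exists>y\<in>Y - X. insert y X \<in> I"

definition matroid_base :: "'a set \<times> 'a set set \<Rightarrow> 'a set \<Rightarrow> bool" where
  "matroid_base M B \<longleftrightarrow> B \<in> snd M \<and> (\<forall>X\<in>snd M. B \<subseteq> X \<longrightarrow> X = B)"

text \<open>A loop at \<open>v\<close> both enters and leaves \<open>v\<close>, so \<open>v\<close> is then neither a source nor a sink.\<close>

definition source :: "'a pair_pre_digraph \<Rightarrow> 'a \<Rightarrow> bool" where
  "source D v \<longleftrightarrow> v \<in> pverts D \<and> in_arcs (with_proj D) v = {}"

definition sink :: "'a pair_pre_digraph \<Rightarrow> 'a \<Rightarrow> bool" where
  "sink D v \<longleftrightarrow> v \<in> pverts D \<and> out_arcs (with_proj D) v = {}"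

text \<open>Paths in \<open>R\<close> are not required to start in \<open>X\<close>.\<close>

definition routing :: "'a pair_pre_digraph \<Rightarrow> 'a set \<Rightarrow> 'a set \<Rightarrow> 'a list set \<Rightarrow> bool" where
  "routing D X Y R \<longleftrightarrow>
     (\<forall>p\<in>R. vpath p (with_proj D)) \<and>
     (\<forall>x\<in>X. \<exists>p\<in>R. hd p = x) \<and>
     (\<forall>p\<in>R. last p \<in> Y) \<and>
     (\<forall>p\<in>R. \<forall>q\<in>R. p = q \<or> set p \<inter> set q = {})"

definition Gamma :: "'a pair_pre_digraph \<Rightarrow> 'a set \<Rightarrow> 'a set \<Rightarrow> 'a set \<times> 'a set set" where
  "Gamma D T E = (E, {X. X \<subseteq> E \<and> (\<exists>R. routing D X T R)})"

definition representation ::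
  "'a pair_pre_digraph \<Rightarrow> 'a set \<Rightarrow> 'a set \<Rightarrow> 'a set \<times> 'a set set \<Rightarrow> bool" where
  "representation D T E M \<longleftrightarrow>
     pair_fin_digraph D \<and> E \<subseteq> pverts D \<and> T \<subseteq> pverts D \<and> M = Gamma D T E"

text \<open>
  A representing digraph may need vertices outside the ground set, and their number is not
  bounded in advance. As ground set and digraph live on the same type, that type has to be
  infinite for the existential quantifier to range, up to renaming of the vertices outside
  \<open>E\<close>, over all finite digraphs with \<open>E \<subseteq> V\<close>.
\<close>

definition gammoid :: "'a::infinite set \<times> 'a set set \<Rightarrow> bool" where
  "gammoid M \<longleftrightarrow> matroid (fst M) (snd M) \<and> (\<exists>D T. representation D T (fst M) M)"

definition standard_representation ::
  "'a pair_pre_digraph \<Rightarrow> 'a set \<Rightarrow> 'a set \<Rightarrow> 'a set \<times> 'a set set \<Rightarrow> bool" where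
  "standard_representation D T E M \<longleftrightarrow>
     representation D T E M \<and> T \<subseteq> E \<and> (\<forall>t\<in>T. sink D t) \<and> (\<forall>e\<in>E - T. source D e)"

end

theory Submission
  imports Defs
begin

text \<open>
  A routing from \<open>X\<close> to \<open>T\<close> in \<open>D = (V, A)\<close> is encoded by an injective map
  \<open>f : V - T \<rightarrow> V - X\<close> that sends every vertex to itself or to one of its successors: on the
  paths \<open>f\<close> is the successor, elsewhere the identity, and conversely the \<open>f\<close>-orbits of the
  elements of \<open>X\<close> are disjoint paths into \<open>T\<close>. If \<open>g\<close> is such a map for a base \<open>B\<close>, then
  \<open>f \<mapsto> f \<circ> g\<^sup>-\<^sup>1\<close> exchanges the target \<open>T\<close> for the complement \<open>B'\<close> of the image of \<open>g\<close>, a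
  superset of \<open>B\<close> consisting of sinks of the new digraph. Since \<open>B\<close> is a base, no vertex of
  \<open>E\<close> reaches \<open>B' - B\<close>, so \<open>B\<close> can serve as the target. Finally, the vertices outside \<open>B\<close> are
  renamed to fresh ones, and each \<open>e \<in> E - B\<close> becomes a source with a single arc to its
  renamed copy.
\<close>

section \<open>Routings encoded as injective maps on the vertices\<close>

definition linking ::
  "'a pair_pre_digraph \<Rightarrow> 'a set \<Rightarrow> 'a set \<Rightarrow> ('a \<Rightarrow> 'a) \<Rightarrow> bool" where
  "linking D T X f \<longleftrightarrow> inj_on f (pverts D - T) \<and>
     (\<forall>v\<in>pverts D - T. f v \<in> pverts D - X \<and> (f v = v \<or> (v, f v) \<in> parcs D))"

lemma set_vwalk_arcs_subset_iff:
  "set (vwalk_arcs p) \<subseteq> S \<longleftrightarrow> (\<forall>i. Suc i < length p \<longrightarrow> (p ! i, p ! Suc i) \<in> S)"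
proof (induction p rule: vwalk_arcs.induct)
  case (3 x y xs)
  then show ?case by (simp add: All_less_Suc2)
qed auto

lemma vpath_with_proj_iff:
  "vpath p (with_proj D) \<longleftrightarrow> p \<noteq> [] \<and> set p \<subseteq> pverts D \<and> distinct p \<and>
     (\<forall>i. Suc i < length p \<longrightarrow> (p ! i, p ! Suc i) \<in> parcs D)"
  by (auto simp: vpath_def vwalk_def set_vwalk_arcs_subset_iff)

lemma routing_mono_target: "routing D X T R \<Longrightarrow> T \<subseteq> T' \<Longrightarrow> routing D X T' R"
  by (auto simp: routing_def)

lemma routing_restrict:
  assumes "routing D X T R"
  shows "routing D X T {p \<in> R. hd p \<in> X}"
  using assms by (auto simp: routing_def)

text \<open>Disjointness makes a vertex determine the path through it, so "successor on a path of
  \<open>R\<close>" is a partial injection. Outside \<open>T\<close> it is undefined exactly at the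
  vertices that lie on no path, because the last vertex of a path is in \<open>T\<close>; there
  \<open>f\<close> is the identity.\<close>

lemma ex_linking_of_routing:
  assumes wf: "pair_wf_digraph D" and R: "routing D X T R"
  shows "\<exists>f. linking D T X f"
proof -
  define step where "step v w \<longleftrightarrow> (\<exists>p\<in>R. \<exists>i. Suc i < length p \<and> v = p ! i \<and> w = p ! Suc i)"
    for v w
  define f where "f v = (if \<exists>w. step v w then SOME w. step v w else v)" for v
  have f_step: "step v (f v)" if "step v w" for v w
    unfolding f_def using that by (auto intro: someI)
  have f_id: "f v = v" if "\<nexists>w. step v w" for v
    using that by (simp add: f_def)
  have path: "p \<noteq> []" "distinct p" "last p \<in> T"
    "\<And>i. Suc i < length p \<Longrightarrow> (p ! i, p ! Suc i) \<in> parcs D" if "p \<in> R" for p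
    using R that by (auto simp: routing_def vpath_with_proj_iff)
  have unique: "p = q" if "p \<in> R" "q \<in> R" "v \<in> set p" "v \<in> set q" for p q v
    using R that unfolding routing_def by blast
  have step_arc: "(v, w) \<in> parcs D" if "step v w" for v w
    using that path(4) by (auto simp: step_def)
  have step_inj: "v = v'" if sv: "step v w" and sv': "step v' w" for v v' w
  proof -
    obtain p i where p: "p \<in> R" "Suc i < length p" "v = p ! i" "w = p ! Suc i"
      using sv unfolding step_def by blast
    obtain q j where q: "q \<in> R" "Suc j < length q" "v' = q ! j" "w = q ! Suc j"
      using sv' unfolding step_def by blast
    have "p = q" using unique[of p q w] p q nth_mem[of "Suc i" p] nth_mem[of "Suc j" q] by auto
    then have "Suc i = Suc j"
      using p q path(2)[OF p(1)] nth_eq_iff_index_eq[of p "Suc i" "Suc j"] by auto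
    then show ?thesis using p q \<open>p = q\<close> by simp
  qed
  have step_exists: "\<exists>w. step v w" if "p \<in> R" "v \<in> set p" "v \<notin> T" for p v
  proof -
    obtain i where i: "i < length p" "v = p ! i"
      using \<open>v \<in> set p\<close> by (metis in_set_conv_nth)
    have "i \<noteq> length p - 1"
      using path(1,3)[OF \<open>p \<in> R\<close>] i \<open>v \<notin> T\<close> by (auto simp: last_conv_nth)
    with i have "step v (p ! Suc i)"
      unfolding step_def using \<open>p \<in> R\<close> by (intro bexI[of _ p] exI[of _ i]) auto
    then show ?thesis ..
  qed
  have step_target: "\<exists>p\<in>R. w \<in> set p" if "step v w" for v w
    using that by (force simp: step_def)
  \<comment> \<open>An element of \<open>X\<close> heads a path of \<open>R\<close>; as a successor
    it would occur on that same path a second time, at a positive position.\<close>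
  have step_notin: "w \<notin> X" if sv: "step v w" for v w
  proof
    assume "w \<in> X"
    then obtain q where q: "q \<in> R" "hd q = w" using R by (auto simp: routing_def)
    obtain p i where p: "p \<in> R" "Suc i < length p" "w = p ! Suc i"
      using sv unfolding step_def by blast
    have "p = q" using unique[OF p(1) q(1), of w] p q(2) path(1)[OF q(1)] hd_in_set[of q] by auto
    then have "p ! 0 = p ! Suc i" using p q path(1)[OF p(1)] by (simp add: hd_conv_nth)
    then show False
      using path(1,2)[OF p(1)] p(2) nth_eq_iff_index_eq[of p 0 "Suc i"] by simp
  qed
  \<comment> \<open>This excludes a collision between a moved \<open>v\<close> and a fixed
    \<open>v'\<close>: if \<open>v'\<close> succeeds \<open>v\<close>, it lies on a path, and
    outside \<open>T\<close> it is not the end of that path, so it is moved as well.\<close>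
  have no_mix: False if "v' \<notin> T" "step v v'" "\<nexists>w. step v' w" for v v'
    using that step_exists step_target by blast
  have "inj_on f (pverts D - T)"
  proof (rule inj_onI)
    fix v v' assume v: "v \<in> pverts D - T" "v' \<in> pverts D - T" and eq: "f v = f v'"
    show "v = v'"
      using v eq f_step f_id step_inj no_mix by (metis DiffD2)
  qed
  moreover have "f v \<in> pverts D - X \<and> (f v = v \<or> (v, f v) \<in> parcs D)"
    if v: "v \<in> pverts D - T" for v
  proof (cases "\<exists>w. step v w")
    case True
    then show ?thesis
      using f_step step_arc step_notin pair_wf_digraph.in_arcsD2[OF wf] by blast
  next
    case False
    have "v \<notin> X"
    proof
      assume "v \<in> X"
      then obtain p where "p \<in> R" "hd p = v" using R by (auto simp: routing_def)
      then show False using step_exists[of p v] path(1)[of p] False v by auto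
    qed
    then show ?thesis using f_id False v by auto
  qed
  ultimately show ?thesis unfolding linking_def by blast
qed

text \<open>The outermost applications of \<open>f\<close> are cancelled one at a time; the last two
  hypotheses keep the arguments in \<open>S\<close>, where \<open>f\<close> is injective.\<close>

lemma funpow_eq_cancel:
  assumes "inj_on f S" "(f ^^ i) x = (f ^^ j) y" "i \<le> j"
    "\<And>k. k < i \<Longrightarrow> (f ^^ k) x \<in> S" "\<And>k. k < j \<Longrightarrow> (f ^^ k) y \<in> S"
  shows "x = (f ^^ (j - i)) y"
  using assms(2-)
proof (induction i arbitrary: j)
  case (Suc i)
  then obtain j' where j: "j = Suc j'" by (cases j) auto
  have "(f ^^ i) x = (f ^^ j') y"
    using Suc.prems assms(1) unfolding j by (auto intro: inj_onD)
  then show ?case using Suc.IH[of j'] Suc.prems unfolding j by simp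
qed simp

lemma ex_routing_of_linking:
  assumes fin: "finite (pverts D)" and X: "X \<subseteq> pverts D" and f: "linking D T X f"
  shows "\<exists>R. routing D X T R"
proof -
  let ?S = "pverts D - T"
  have inj: "inj_on f ?S"
    and fS: "\<And>v. v \<in> ?S \<Longrightarrow> f v \<in> pverts D - X \<and> (f v = v \<or> (v, f v) \<in> parcs D)"
    using f by (auto simp: linking_def)
  \<comment> \<open>Cancelling leaves \<open>x\<close> as the iterate of \<open>y\<close> of order
    \<open>j - i\<close>. If this order is positive, \<open>x\<close> is a value of
    \<open>f\<close>, but the values of \<open>f\<close> avoid \<open>X\<close>. This one fact
    yields that each path is repetition-free and that different paths are disjoint.\<close>
  have orbit: "i = j \<and> x = y"
    if "x \<in> X" "y \<in> X" "(f ^^ i) x = (f ^^ j) y"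
      "\<forall>k<i. (f ^^ k) x \<in> ?S" "\<forall>k<j. (f ^^ k) y \<in> ?S" for x y i j
    using that
  proof (induction i j arbitrary: x y rule: linorder_wlog)
    case (le i j)
    have x: "x = (f ^^ (j - i)) y"
      using funpow_eq_cancel[OF inj le.prems(3) \<open>i \<le> j\<close>] le.prems by blast
    show ?case
    proof (cases "i = j")
      case False
      then obtain k where k: "j - i = Suc k" using \<open>i \<le> j\<close> by (cases "j - i") auto
      then have "(f ^^ k) y \<in> ?S" using le.prems by simp
      with fS x k \<open>x \<in> X\<close> show ?thesis by auto
    qed (use x in simp)
  next
    case (sym i j)
    from sym.IH[of y x] sym.prems show ?case by auto
  qed
  \<comment> \<open>An orbit that never meets \<open>T\<close> would, by \<open>orbit\<close>,
    consist of infinitely many distinct vertices.\<close>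
  have ends: "\<exists>n. (f ^^ n) x \<in> T" if "x \<in> X" for x
  proof (rule ccontr)
    assume none: "\<nexists>n. (f ^^ n) x \<in> T"
    have S: "(f ^^ n) x \<in> ?S" for n
    proof (induction n)
      case (Suc n)
      then have "(f ^^ Suc n) x \<in> pverts D" using fS by simp
      then show ?case using none by blast
    qed (use none X \<open>x \<in> X\<close> in \<open>auto dest: spec[of _ 0]\<close>)
    then have "range (\<lambda>n. (f ^^ n) x) \<subseteq> pverts D" by blast
    moreover have "inj (\<lambda>n. (f ^^ n) x)"
      using orbit[OF \<open>x \<in> X\<close> \<open>x \<in> X\<close>] S by (auto intro!: injI)
    ultimately show False
      using fin finite_subset range_inj_infinite by blast
  qed
  \<comment> \<open>The path of \<open>x\<close> stops at the first visit to \<open>T\<close>; for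
    \<open>x\<close> in \<open>T\<close> this is 0 and the path is the single vertex
    \<open>x\<close>.\<close>
  define len where "len x = (LEAST n. (f ^^ n) x \<in> T)" for x
  have len_T: "(f ^^ len x) x \<in> T" if "x \<in> X" for x
    using ends[OF that] unfolding len_def by (rule LeastI_ex)
  have before: "(f ^^ k) x \<in> ?S" if "x \<in> X" "k < len x" for x k
    using that(2)
  proof (induction k)
    case 0
    then show ?case using not_less_Least[of 0 "\<lambda>n. (f ^^ n) x \<in> T"] X \<open>x \<in> X\<close>
      by (auto simp: len_def)
  next
    case (Suc k)
    then have "(f ^^ Suc k) x \<in> pverts D" using fS by simp
    then show ?case using Suc.prems not_less_Least[of "Suc k" "\<lambda>n. (f ^^ n) x \<in> T"]
      by (auto simp: len_def)
  qed
  have verts: "(f ^^ k) x \<in> pverts D" if "x \<in> X" "k \<le> len x" for x k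
  proof (cases k)
    case (Suc k')
    then show ?thesis using before[of x k'] fS that by simp
  qed (use that X in auto)
  have orbit': "i = j \<and> x = y"
    if "x \<in> X" "y \<in> X" "(f ^^ i) x = (f ^^ j) y" "i \<le> len x" "j \<le> len y" for x y i j
    using orbit[OF that(1-3)] before that by simp
  define P where "P x = map (\<lambda>i. (f ^^ i) x) [0..<Suc (len x)]" for x
  have set_P: "set (P x) = (\<lambda>i. (f ^^ i) x) ` {..len x}" for x
    unfolding P_def by (simp only: set_map set_upt atLeast0LessThan lessThan_Suc_atMost)
  have nth_P: "P x ! i = (f ^^ i) x" if "i \<le> len x" for x i
    unfolding P_def using that by (simp del: upt_Suc)
  have length_P: "length (P x) = Suc (len x)" for x
    by (simp add: P_def)
  have P_Nil: "P x \<noteq> []" for x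
    using length_P[of x] by auto
  have path_P: "vpath (P x) (with_proj D)" if x: "x \<in> X" for x
  proof -
    have "distinct (P x)"
      unfolding distinct_conv_nth using orbit'[OF x x] by (auto simp: length_P nth_P)
    moreover have "(P x ! i, P x ! Suc i) \<in> parcs D" if i: "Suc i < length (P x)" for i
    proof -
      have S: "(f ^^ i) x \<in> ?S" and "i < len x"
        using before[OF x, of i] i by (auto simp: length_P)
      \<comment> \<open>This rules out the alternative \<open>f v = v\<close> in
        \<open>linking\<close>, so an arc remains.\<close>
      have "(f ^^ Suc i) x \<noteq> (f ^^ i) x"
        using orbit'[OF x x, of "Suc i" i] \<open>i < len x\<close> by auto
      then show ?thesis using fS[OF S] \<open>i < len x\<close> by (simp add: nth_P)
    qed
    ultimately show ?thesis
      using verts[OF x] P_Nil by (auto simp: vpath_with_proj_iff set_P)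
  qed
  have hd_P: "hd (P x) = x" for x
    by (simp add: hd_conv_nth P_Nil nth_P)
  have last_P: "last (P x) \<in> T" if "x \<in> X" for x
    using len_T[OF that] by (simp add: last_conv_nth P_Nil length_P nth_P)
  have disjoint_P: "x = y \<or> set (P x) \<inter> set (P y) = {}" if "x \<in> X" "y \<in> X" for x y
    using orbit'[OF that] by (fastforce simp: set_P)
  have "routing D X T (P ` X)"
    unfolding routing_def using path_P hd_P last_P disjoint_P by blast
  then show ?thesis ..
qed

lemma ex_routing_iff_ex_linking:
  assumes "pair_fin_digraph D" "X \<subseteq> pverts D"
  shows "(\<exists>R. routing D X T R) \<longleftrightarrow> (\<exists>f. linking D T X f)"
proof -
  interpret pair_fin_digraph D by fact
  show ?thesis
    using ex_linking_of_routing[OF pair_wf_digraph_axioms]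
      ex_routing_of_linking[OF pair_finite_verts assms(2)] by blast
qed

section \<open>Exchanging the target along a linking\<close>

lemma source_iff: "source D v \<longleftrightarrow> v \<in> pverts D \<and> (\<forall>u. (u, v) \<notin> parcs D)"
  by (auto simp: source_def in_arcs_def)

lemma sink_iff: "sink D v \<longleftrightarrow> v \<in> pverts D \<and> (\<forall>w. (v, w) \<notin> parcs D)"
  by (auto simp: sink_def out_arcs_def)

lemma pair_fin_digraphI:
  assumes "finite (pverts D)" "parcs D \<subseteq> pverts D \<times> pverts D"
  shows "pair_fin_digraph D"
  using assms finite_subset[OF assms(2)] by unfold_locales auto

lemma pair_fin_digraph_parcs_subset:
  assumes "pair_fin_digraph D"
  shows "parcs D \<subseteq> pverts D \<times> pverts D"
proof -
  interpret pair_fin_digraph D by fact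
  show ?thesis by (auto dest: wellformed')
qed

lemma exchange_target:
  assumes D: "pair_fin_digraph D" and g: "linking D T B g" and B: "B \<subseteq> pverts D"
  obtains D' B' where "pair_fin_digraph D'" "pverts D' = pverts D" "B \<subseteq> B'"
    "\<forall>b\<in>B'. sink D' b"
    "\<forall>X\<subseteq>pverts D. (\<exists>R. routing D' X B' R) \<longleftrightarrow> (\<exists>R. routing D X T R)"
proof -
  interpret pair_fin_digraph D by fact
  let ?V = "pverts D"
  define B' where "B' = ?V - g ` (?V - T)"
  define h where "h = inv_into (?V - T) g"
  \<comment> \<open>The out-neighbours of \<open>w\<close> are exactly the values open to a linking
    of \<open>D\<close> at \<open>h w\<close>: the arc from \<open>w\<close> to \<open>h w\<close>
    stands for leaving \<open>h w\<close> fixed. Vertices of \<open>B'\<close> get no outgoing arcs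
    and thus become sinks.\<close>
  define D' where "D' = \<lparr>pverts = ?V,
    parcs = {(w, u). w \<in> ?V - B' \<and> u \<in> ?V \<and> (u = h w \<or> (h w, u) \<in> parcs D)}\<rparr>"
  have inj: "inj_on g (?V - T)"
    and gV: "\<And>v. v \<in> ?V - T \<Longrightarrow> g v \<in> ?V - B \<and> (g v = v \<or> (v, g v) \<in> parcs D)"
    using g by (auto simp: linking_def)
  have image: "g ` (?V - T) = ?V - B'"
    using gV by (auto simp: B'_def)
  have hg: "h (g v) = v" if "v \<in> ?V - T" for v
    unfolding h_def using inv_into_f_f[OF inj that] .
  have gh: "g (h w) = w" "h w \<in> ?V - T" if "w \<in> ?V - B'" for w
    using that image f_inv_into_f[of w g "?V - T"] inv_into_into[of w g "?V - T"]
    by (auto simp: h_def)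
  have D': "pair_fin_digraph D'"
    by (rule pair_fin_digraphI) (auto simp: D'_def pair_finite_verts)
  have "(\<exists>f. linking D' B' X f) \<longleftrightarrow> (\<exists>f. linking D T X f)" for X
  proof
    assume "\<exists>f. linking D' B' X f"
    then obtain f where f: "linking D' B' X f" ..
    have "inj_on (f \<circ> g) (?V - T)"
      using f inj unfolding linking_def image[symmetric] by (auto simp: D'_def image intro: comp_inj_on)
    moreover have "(f \<circ> g) v \<in> ?V - X \<and> ((f \<circ> g) v = v \<or> (v, (f \<circ> g) v) \<in> parcs D)"
      if v: "v \<in> ?V - T" for v
    proof -
      have "g v \<in> ?V - B'" using v image by blast
      \<comment> \<open>If \<open>f\<close> fixes \<open>g v\<close>, the composition has value
        \<open>g v\<close> at \<open>v\<close>, which is admissible because \<open>g\<close> is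
        itself a linking of \<open>D\<close>.\<close>
      then have "f (g v) \<in> ?V - X \<and> (f (g v) = g v \<or> f (g v) = v \<or> (v, f (g v)) \<in> parcs D)"
        using f hg[OF v] by (auto simp: linking_def D'_def)
      then show ?thesis using gV[OF v] by auto
    qed
    ultimately show "\<exists>f. linking D T X f" unfolding linking_def by blast
  next
    assume "\<exists>f. linking D T X f"
    then obtain f where f: "linking D T X f" ..
    have "inj_on (f \<circ> h) (?V - B')"
      using f gh by (intro comp_inj_on) (auto simp: linking_def intro!: inj_onI dest: inj_onD, metis)
    moreover have "(f \<circ> h) w \<in> ?V - X \<and> (w, (f \<circ> h) w) \<in> parcs D'"
      if w: "w \<in> ?V - B'" for w
      using f gh(2)[OF w] w by (auto simp: linking_def D'_def)
    ultimately show "\<exists>f. linking D' B' X f"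
      unfolding linking_def by (intro exI[of _ "f \<circ> h"]) (auto simp: D'_def)
  qed
  then have "(\<exists>R. routing D' X B' R) \<longleftrightarrow> (\<exists>R. routing D X T R)" if "X \<subseteq> ?V" for X
    using ex_routing_iff_ex_linking[OF D', of X] ex_routing_iff_ex_linking[OF D that] that
    by (auto simp: D'_def)
  moreover have "B \<subseteq> B'" using B gV by (auto simp: B'_def)
  moreover have "sink D' b" if "b \<in> B'" for b
    using that by (auto simp: sink_iff D'_def B'_def)
  ultimately show ?thesis
    using that[of D' B'] D' by (auto simp: D'_def B'_def)
qed

section \<open>Cutting the target down to the base\<close>

text \<open>A path ending in \<open>B' - B\<close> avoids \<open>B\<close>, whose elements are sinks
  and could only be its last vertex. If it started in \<open>X\<close>, it could be joined with the
  one-vertex paths at the elements of \<open>B\<close>, and \<open>B\<close> together with its first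
  vertex would be routed to \<open>B'\<close>, against maximality.\<close>

lemma routing_restrict_target:
  assumes R: "routing D X B' R" and X: "X \<subseteq> E"
    and B: "B \<subseteq> B'" "B \<subseteq> E" "\<And>b. b \<in> B' \<Longrightarrow> sink D b"
    and max: "\<And>Y R. B \<subseteq> Y \<Longrightarrow> Y \<subseteq> E \<Longrightarrow> routing D Y B' R \<Longrightarrow> Y = B"
  shows "\<exists>R. routing D X B R"
proof -
  have "last p \<in> B" if p: "p \<in> R" "hd p \<in> X" for p
  proof (rule ccontr)
    assume nB: "last p \<notin> B"
    have path: "vpath p (with_proj D)" and last: "last p \<in> B'"
      using R p by (auto simp: routing_def)
    have disj: "set p \<inter> B = {}"
    proof (rule equals0I)
      fix b assume b: "b \<in> set p \<inter> B"
      then obtain i where i: "i < length p" "b = p ! i"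
        by (auto simp: in_set_conv_nth)
      then have "i \<noteq> length p - 1"
        using nB b path by (auto simp: last_conv_nth vpath_with_proj_iff)
      then have "(b, p ! Suc i) \<in> parcs D" using path i by (auto simp: vpath_with_proj_iff)
      then show False using B b by (auto simp: sink_iff)
    qed
    have "routing D (insert (hd p) B) B' (insert p ((\<lambda>b. [b]) ` B))"
      using path last disj B by (auto simp: routing_def vpath_with_proj_iff sink_iff)
    then have "insert (hd p) B = B"
      using max[of "insert (hd p) B"] B(2) X p by auto
    moreover have "hd p \<in> set p" using path by (auto simp: vpath_with_proj_iff)
    ultimately show False using disj by auto
  qed
  \<comment> \<open>Paths of \<open>R\<close> that do not start in \<open>X\<close> may still end in
    \<open>B' - B\<close>, so they are discarded.\<close>
  then have "routing D X B {p \<in> R. hd p \<in> X}"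
    using routing_restrict[OF R] by (auto simp: routing_def)
  then show ?thesis ..
qed

section \<open>Renaming vertices and creating sources\<close>

text \<open>The infinite type supplies enough new vertices. They avoid \<open>E\<close> so that the
  ground set is free to be attached anew, and \<open>B \<inter> V\<close>, which \<open>r\<close>
  fixes, so that \<open>r\<close> stays injective.\<close>

lemma ex_fresh_renaming:
  fixes V B E :: "'a::infinite set"
  assumes "finite V" "finite E"
  obtains r where "inj_on r V" "\<And>b. b \<in> B \<Longrightarrow> r b = b" "r ` (V - B) \<inter> (E \<union> B \<inter> V) = {}"
proof -
  have "infinite (- (E \<union> B \<inter> V))"
    unfolding Compl_eq_Diff_UNIV using assms infinite_UNIV by (intro Diff_infinite_finite) auto
  then obtain W where W: "W \<subseteq> - (E \<union> B \<inter> V)" "finite W" "card W = card (V - B)"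
    using infinite_arbitrarily_large by blast
  then obtain h where h: "bij_betw h (V - B) W"
    using assms(1) finite_same_card_bij[of "V - B" W] by auto
  define r where "r v = (if v \<in> B then v else h v)" for v
  have "r ` (V - B) = W"
    using h by (auto simp: r_def bij_betw_def)
  moreover have "inj_on r V"
    using h W(1) unfolding r_def inj_on_def bij_betw_def by (auto split: if_splits)
  ultimately show ?thesis using that[of r] W(1) by (auto simp: r_def)
qed

text \<open>A path from \<open>e\<close> in \<open>E - B\<close> is prolonged by the arc from
  \<open>e\<close> to its copy \<open>r e\<close>. For linkings, the elements of
  \<open>X - B\<close> must move to their copies and thereby block them for all other vertices; this
  reproduces the condition that a linking of \<open>D\<close> avoids \<open>X\<close>.\<close>

lemma make_sources:
  fixes D :: "'a::infinite pair_pre_digraph"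
  assumes D: "pair_fin_digraph D" and E: "E \<subseteq> pverts D" and B: "B \<subseteq> E"
    and sinks: "\<And>b. b \<in> B \<Longrightarrow> sink D b"
  obtains D' where "pair_fin_digraph D'" "E \<subseteq> pverts D'"
    "\<forall>b\<in>B. sink D' b" "\<forall>e\<in>E - B. source D' e"
    "\<forall>X\<subseteq>E. (\<exists>R. routing D' X B R) \<longleftrightarrow> (\<exists>R. routing D X B R)"
proof -
  interpret pair_fin_digraph D by fact
  let ?V = "pverts D"
  have finE: "finite E" using E pair_finite_verts finite_subset by blast
  obtain r where inj: "inj_on r ?V" and r_B: "\<And>b. b \<in> B \<Longrightarrow> r b = b"
    and fresh0: "r ` (?V - B) \<inter> (E \<union> B \<inter> ?V) = {}"
    using ex_fresh_renaming[OF pair_finite_verts finE] by blast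
  have fresh: "r v \<notin> E" if "v \<in> ?V" "v \<notin> B" for v
    using fresh0 that by blast
  have r_mem: "v \<in> B \<and> r v = v" if "v \<in> ?V" "r v \<in> E" for v
    using that fresh r_B by blast
  have r_eq: "r v = r w \<longleftrightarrow> v = w" if "v \<in> ?V" "w \<in> ?V" for v w
    using inj that by (auto dest: inj_onD)
  have BV: "B \<subseteq> ?V" using B E by blast
  define D' where "D' = \<lparr>pverts = r ` ?V \<union> E,
    parcs = map_prod r r ` parcs D \<union> (\<lambda>e. (e, r e)) ` (E - B)\<rparr>"
  have arcs: "parcs D \<subseteq> ?V \<times> ?V" using pair_fin_digraph_parcs_subset[OF D] .
  have D': "pair_fin_digraph D'"
    using arcs E by (intro pair_fin_digraphI) (auto simp: D'_def pair_finite_verts finE)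
  have diff: "pverts D' - B = r ` (?V - B) \<union> (E - B)"
    using r_B fresh B by (auto simp: D'_def)
  have "(\<exists>f. linking D' B X f) \<longleftrightarrow> (\<exists>f. linking D B X f)" if X: "X \<subseteq> E" for X
  proof
    assume "\<exists>f. linking D' B X f"
    then obtain f where injf: "inj_on f (pverts D' - B)"
      and f: "\<And>v. v \<in> pverts D' - B \<Longrightarrow> f v \<in> pverts D' - X \<and> (f v = v \<or> (v, f v) \<in> parcs D')"
      by (auto simp: linking_def)
    \<comment> \<open>The values of \<open>f\<close> avoid \<open>X\<close>, so \<open>x\<close>
      cannot stay fixed. Its only outgoing arc leads to \<open>r x\<close>, since renamed arcs leave
      no vertex of \<open>E - B\<close>.\<close>
    have f_E: "f x = r x" if "x \<in> X - B" for x
    proof -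
      have "x \<in> E - B" using that X by auto
      then have "(x, f x) \<in> parcs D'" "x \<in> E - B"
        using f[of x] that by (auto simp: diff)
      then show ?thesis
        using arcs by (auto simp: D'_def dest!: r_mem)
    qed
    have f_r: "\<exists>w\<in>?V. f (r v) = r w \<and> (w = v \<or> (v, w) \<in> parcs D) \<and> w \<notin> X"
      if v: "v \<in> ?V - B" for v
    proof -
      have rv: "r v \<in> pverts D' - B" "r v \<notin> E" using v fresh diff by auto
      have "f (r v) = r v \<or> (r v, f (r v)) \<in> map_prod r r ` parcs D"
        using f[OF rv(1)] rv(2) by (auto simp: D'_def)
      then obtain w where w: "w \<in> ?V" "f (r v) = r w" "w = v \<or> (v, w) \<in> parcs D"
        using v arcs by (auto simp: r_eq)
      \<comment> \<open>For \<open>w\<close> in \<open>B\<close> the value \<open>r w = w\<close>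
        would lie in \<open>X\<close>. Otherwise \<open>w\<close> already occupies
        \<open>r w\<close>, so injectivity gives \<open>w = r v\<close>, although \<open>r v\<close>
        is not in \<open>E\<close>.\<close>
      have "w \<notin> X"
      proof
        assume wX: "w \<in> X"
        show False
        proof (cases "w \<in> B")
          case True
          then show False using f[OF rv(1)] w(2) r_B wX by auto
        next
          case False
          then have "f w = f (r v)" using f_E wX w by auto
          moreover have "w \<in> pverts D' - B" using X wX False by (auto simp: diff)
          ultimately have "w = r v" using injf rv(1) by (auto dest: inj_onD)
          then show False using rv(2) X wX by auto
        qed
      qed
      with w show ?thesis by auto
    qed
    then obtain f' where f': "\<And>v. v \<in> ?V - B \<Longrightarrow> f' v \<in> ?V \<and> f (r v) = r (f' v) \<and>
        (f' v = v \<or> (v, f' v) \<in> parcs D) \<and> f' v \<notin> X"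
      by metis
    have "inj_on f' (?V - B)"
    proof (rule inj_onI)
      fix v w assume vw: "v \<in> ?V - B" "w \<in> ?V - B" "f' v = f' w"
      then have "f (r v) = f (r w)" using f' by simp
      then have "r v = r w" using injf vw by (auto simp: diff dest: inj_onD)
      then show "v = w" using r_eq vw by auto
    qed
    then show "\<exists>f. linking D B X f"
      using f' by (auto simp: linking_def)
  next
    assume "\<exists>f. linking D B X f"
    then obtain f where injf: "inj_on f (?V - B)"
      and f: "\<And>v. v \<in> ?V - B \<Longrightarrow> f v \<in> ?V - X \<and> (f v = v \<or> (v, f v) \<in> parcs D)"
      by (auto simp: linking_def)
    let ?s = "inv_into ?V r"
    have s: "?s (r v) = v" if "v \<in> ?V" for v using inv_into_f_f[OF inj that] .
    \<comment> \<open>Sources in \<open>X\<close> take the forced step, the other sources stay, and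
      the copies follow \<open>f\<close> conjugated by \<open>r\<close>.\<close>
    define f' where "f' v = (if v \<in> X then r v else if v \<in> E then v else r (f (?s v)))" for v
    have f'_r: "f' (r v) = r (f v)" if "v \<in> ?V - B" for v
      using fresh[of v] that s[of v] X by (auto simp: f'_def)
    have f'_E: "f' e = (if e \<in> X then r e else e)" if "e \<in> E" for e
      using that by (simp add: f'_def)
    have f'_mem: "f' v \<in> pverts D' - X \<and> (f' v = v \<or> (v, f' v) \<in> parcs D')"
      if v: "v \<in> pverts D' - B" for v
    proof (cases "v \<in> E")
      case True
      then have "r v \<notin> X" using fresh[of v] E X v by auto
      then show ?thesis using f'_E[OF True] True v E by (auto simp: D'_def)
    next
      case False
      then obtain u where u: "u \<in> ?V - B" "v = r u" using v diff by auto
      have "r (f u) \<notin> X" using f[OF u(1)] X r_mem[of "f u"] by auto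
      then show ?thesis using f[OF u(1)] f'_r[OF u(1)] u by (auto simp: D'_def)
    qed
    \<comment> \<open>The value \<open>r (f v)\<close> is not the copy of an element of
      \<open>X\<close>, because \<open>f\<close> avoids \<open>X\<close>, and it lies in
      \<open>E\<close> only when it is in \<open>B\<close>; so it meets neither kind of value on
      \<open>E - B\<close>.\<close>
    have cross: "f' (r v) \<noteq> f' e" if v: "v \<in> ?V - B" and e: "e \<in> E - B" for v e
    proof
      assume eq: "f' (r v) = f' e"
      have fv: "f v \<in> ?V" "f v \<notin> X" using f[OF v] by auto
      have "e \<in> ?V" using e E by auto
      show False
      proof (cases "e \<in> X")
        case True
        then show False using eq f'_r[OF v] f'_E e r_eq[OF fv(1) \<open>e \<in> ?V\<close>] fv(2) by auto
      next
        case False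
        then show False using eq f'_r[OF v] f'_E e r_mem[OF fv(1)] by auto
      qed
    qed
    have "inj_on f' (pverts D' - B)"
      unfolding diff inj_on_Un
    proof (intro conjI)
      show "inj_on f' (r ` (?V - B))"
      proof (rule inj_onI, elim imageE)
        fix a b v w assume "f' a = f' b" "a = r v" "b = r w" "v \<in> ?V - B" "w \<in> ?V - B"
        moreover from this have "r (f v) = r (f w)" using f'_r by simp
        ultimately show "a = b" using r_eq[of "f v" "f w"] f injf by (auto dest: inj_onD)
      qed
      show "inj_on f' (E - B)"
      proof (rule inj_onI)
        fix a b assume ab: "a \<in> E - B" "b \<in> E - B" "f' a = f' b"
        moreover from ab have "a \<in> ?V" "b \<in> ?V" using E by auto
        ultimately show "a = b"
          using f'_E[of a] f'_E[of b] fresh[of a] fresh[of b] r_eq[of a b]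
          by (auto split: if_splits)
      qed
      show "f' ` (r ` (?V - B) - (E - B)) \<inter> f' ` (E - B - r ` (?V - B)) = {}"
        using cross by fast
    qed
    then show "\<exists>f. linking D' B X f"
      using f'_mem unfolding linking_def by blast
  qed
  moreover have ED': "E \<subseteq> pverts D'" by (auto simp: D'_def)
  ultimately have ex_iff: "(\<exists>R. routing D' X B R) \<longleftrightarrow> (\<exists>R. routing D X B R)" if "X \<subseteq> E" for X
    using ex_routing_iff_ex_linking[OF D', of X] ex_routing_iff_ex_linking[OF D, of X] that E
    by auto
  have "sink D' b" if b: "b \<in> B" for b
    using sinks r_mem arcs b B ED' by (force simp: sink_iff D'_def)
  moreover have "source D' e" if e: "e \<in> E - B" for e
    using e r_mem arcs E ED' by (force simp: source_iff D'_def)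
  ultimately show ?thesis
    using ex_iff by (intro that[OF D' ED'] ballI allI impI)
qed

theorem theorem2p4:
  fixes E B :: "'a::infinite set" and I :: "'a set set"
  assumes "gammoid (E, I)"
    and "B \<subseteq> E"
    and "matroid_base (E, I) B"
  shows "\<exists>D. standard_representation D B E (E, I)"
proof -
  obtain D T where D: "pair_fin_digraph D" and E: "E \<subseteq> pverts D"
    and I: "I = {X. X \<subseteq> E \<and> (\<exists>R. routing D X T R)}"
    using assms(1) by (auto simp: gammoid_def representation_def Gamma_def)
  have "B \<in> I" and max: "\<And>X. X \<in> I \<Longrightarrow> B \<subseteq> X \<Longrightarrow> X = B"
    using assms(3) by (auto simp: matroid_base_def)
  have BV: "B \<subseteq> pverts D" using assms(2) E by blast
  then obtain g where g: "linking D T B g"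
    using \<open>B \<in> I\<close> ex_routing_iff_ex_linking[OF D] by (auto simp: I)
  obtain D1 B1 where D1: "pair_fin_digraph D1" "pverts D1 = pverts D"
    and B1: "B \<subseteq> B1" "\<forall>b\<in>B1. sink D1 b"
    and eq1: "\<forall>X\<subseteq>pverts D. (\<exists>R. routing D1 X B1 R) \<longleftrightarrow> (\<exists>R. routing D X T R)"
    by (rule exchange_target[OF D g BV])
  have in_I: "X \<in> I \<longleftrightarrow> (\<exists>R. routing D1 X B1 R)" if "X \<subseteq> E" for X
    using that E eq1 by (auto simp: I)
  \<comment> \<open>The maximality of \<open>B\<close> enters here, carried over to
    \<open>D1\<close> by \<open>in_I\<close>; the construction of \<open>D1\<close> used only the
    independence of \<open>B\<close>.\<close>
  have eq2: "(\<exists>R. routing D1 X B R) \<longleftrightarrow> X \<in> I" if X: "X \<subseteq> E" for X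
  proof
    assume "\<exists>R. routing D1 X B R"
    then show "X \<in> I" using in_I[OF X] routing_mono_target[OF _ B1(1)] by blast
  next
    assume "X \<in> I"
    then obtain R where "routing D1 X B1 R" using in_I[OF X] by blast
    then show "\<exists>R. routing D1 X B R"
    proof (rule routing_restrict_target)
      show "Y = B" if "B \<subseteq> Y" "Y \<subseteq> E" "routing D1 Y B1 R" for Y R
        using max in_I that by blast
    qed (use X B1 assms(2) in auto)
  qed
  have "E \<subseteq> pverts D1" and "\<And>b. b \<in> B \<Longrightarrow> sink D1 b"
    using E D1(2) B1 by auto
  from make_sources[OF D1(1) this(1) assms(2) this(2)]
  obtain D2 where D2: "pair_fin_digraph D2" "E \<subseteq> pverts D2"
    "\<forall>b\<in>B. sink D2 b" "\<forall>e\<in>E - B. source D2 e"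
    and eq3: "\<forall>X\<subseteq>E. (\<exists>R. routing D2 X B R) \<longleftrightarrow> (\<exists>R. routing D1 X B R)" .
  have "X \<subseteq> E" if "X \<in> I" for X using that by (simp add: I)
  then have "I = {X. X \<subseteq> E \<and> (\<exists>R. routing D2 X B R)}"
    using eq2 eq3 by (intro set_eqI) auto
  then have "standard_representation D2 B E (E, I)"
    using D2 assms(2) by (auto simp: standard_representation_def representation_def Gamma_def)
  then show ?thesis ..
qed

end
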